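(* The Restructure Mechanism (Res-M) is strategyproof and optimal for minimizing the social cost when locations are private and group memberships are public; optimal means that for every profile $\mathbf r$ its output $y$ satisfies $\mathrm{SC}(y,\mathbf r)=\min_{z\in[0,1]}\mathrm{SC}(z,\mathbf r)$.
   Context: Setting. $N=\{1,\dots,n\}$ is a set of agents, $I=[0,1]$, $[m]=\{1,\dots,m\}$ indexes groups. Agent $i$ has a profile $r_i=(x_i,g_i)$ with location $x_i\in I$ and group $g_i\in[m]$; $\mathbf r=(r_1,\dots,r_n)$. $G_j=\{i\in N: g_i=j\}$. $d(a,b)=|a-b|$. Each group $j$ has a known externality factor $\alpha_j\ge 0$. If the facility is at $y\in I$, the cost of agent $i$ is $$c_i(y,\mathbf r)=d(y,x_i)+\alpha_{g_i}\sum_{k\in G_{g_i}\setminus\{i\}}(1-d(y,x_k)).$$ Standing assumption: $\alpha_j\le 1/(|G_j|-1)$ for each group $j$ (void if $|G_j|\le 1$). Social cost: $\mathrm{SC}(y,\mathbf r)=\sum_{i\in N}c_i(y,\mathbf r)$. A (deterministic) mechanism $f$ maps a profile to a facility location in $I$. Strategyproof when locations are private and group memberships are public: for every true profile $\mathbf r$, every reported profile $\mathbf r'$ with the same group memberships ($g'_k=g_k$ for all $k$) and every agent $i$, $c_i(f(r_i,\mathbf r'_{-i}),\mathbf r)\le c_i(f(\mathbf r'),\mathbf r)$, where $\mathbf r'_{-i}$ are the reports of all agents other than $i$. Res-M: let $w_i=1-\alpha_{g_i}(|G_{g_i}|-1)$, and for $y\in I$ let $L(y)=\{i: x_i\le y\}$,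 $R(y)=\{i: x_i>y\}$. Output the smallest agent location $x^*\in\{x_1,\dots,x_n\}$ such that $\sum_{i\in L(x^* )}w_i\ge\sum_{i\in R(x^* )}w_i$. *)

theory Defs
  imports Complex_Main "HOL-Library.FuncSet"
begin

type_synonym profile = "nat \<Rightarrow> real \<times> nat"

abbreviation loc :: "profile \<Rightarrow> nat \<Rightarrow> real" where
  "loc r i \<equiv> fst (r i)"

abbreviation grp :: "profile \<Rightarrow> nat \<Rightarrow> nat" where
  "grp r i \<equiv> snd (r i)"

definition members :: "nat \<Rightarrow> profile \<Rightarrow> nat \<Rightarrow> nat set" where
  "members n r j = {i \<in> {1..n}. grp r i = j}"

text \<open>The agents are \<open>1, \<dots>, n\<close> and the groups \<open>1, \<dots>, m\<close>; extensional functions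
  make profiles correspond exactly to \<open>n\<close>-tuples. The bound on the externality factors
  \<open>\<alpha>\<close> depends on the group sizes and is therefore a condition on the profile; it
  involves the group memberships only, so misreporting a location preserves it.\<close>

definition profiles :: "nat \<Rightarrow> nat \<Rightarrow> (nat \<Rightarrow> real) \<Rightarrow> profile set" where
  "profiles n m \<alpha> =
    {r \<in> {1..n} \<rightarrow>\<^sub>E {0..1} \<times> {1..m}.
      \<forall>j\<in>{1..m}. 1 < card (members n r j) \<longrightarrow> \<alpha> j \<le> 1 / (real (card (members n r j)) - 1)}"

definition cost :: "nat \<Rightarrow> (nat \<Rightarrow> real) \<Rightarrow> nat \<Rightarrow> real \<Rightarrow> profile \<Rightarrow> real" where
  "cost n \<alpha> i y r =
    \<bar>y - loc r i\<bar> + \<alpha> (grp r i) * (\<Sum>k\<in>members n r (grp r i) - {i}. 1 - \<bar>y - loc r k\<bar>)"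

definition social_cost :: "nat \<Rightarrow> (nat \<Rightarrow> real) \<Rightarrow> real \<Rightarrow> profile \<Rightarrow> real" where
  "social_cost n \<alpha> y r = (\<Sum>i\<in>{1..n}. cost n \<alpha> i y r)"

text \<open>Locations are private and group memberships are public: the reported profile \<open>r'\<close>
  may differ from the true profile \<open>r\<close> in the locations of all agents, but not in the groups.
  Costs are evaluated at the true profile.\<close>

definition strategyproof ::
    "nat \<Rightarrow> nat \<Rightarrow> (nat \<Rightarrow> real) \<Rightarrow> (profile \<Rightarrow> real) \<Rightarrow> bool" where
  "strategyproof n m \<alpha> f \<longleftrightarrow>
    (\<forall>r\<in>profiles n m \<alpha>. \<forall>r'\<in>profiles n m \<alpha>. (\<forall>k\<in>{1..n}. grp r' k = grp r k) \<longrightarrow>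
      (\<forall>i\<in>{1..n}. cost n \<alpha> i (f (r'(i := r i))) r \<le> cost n \<alpha> i (f r') r))"

text \<open>Since \<^const>\<open>is_arg_min\<close> includes feasibility, an optimal \<open>f\<close> maps every profile
  into \<open>[0, 1]\<close>.\<close>

definition optimal ::
    "nat \<Rightarrow> nat \<Rightarrow> (nat \<Rightarrow> real) \<Rightarrow> (profile \<Rightarrow> real) \<Rightarrow> bool" where
  "optimal n m \<alpha> f \<longleftrightarrow>
    (\<forall>r\<in>profiles n m \<alpha>. is_arg_min (\<lambda>z. social_cost n \<alpha> z r) (\<lambda>z. z \<in> {0..1}) (f r))"

definition weight :: "nat \<Rightarrow> (nat \<Rightarrow> real) \<Rightarrow> profile \<Rightarrow> nat \<Rightarrow> real" where
  "weight n \<alpha> r i = 1 - \<alpha> (grp r i) * (real (card (members n r (grp r i))) - 1)"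

text \<open>For \<open>n \<ge> 1\<close> and a profile in \<^const>\<open>profiles\<close> with \<open>\<alpha> \<ge> 0\<close>, the set below is
  nonempty: the weights are nonnegative, so the largest agent location belongs to it.\<close>

definition res_m :: "nat \<Rightarrow> (nat \<Rightarrow> real) \<Rightarrow> profile \<Rightarrow> real" where
  "res_m n \<alpha> r =
    Min {y \<in> loc r ` {1..n}.
      (\<Sum>i\<in>{i \<in> {1..n}. loc r i \<le> y}. weight n \<alpha> r i)
        \<ge> (\<Sum>i\<in>{i \<in> {1..n}. loc r i > y}. weight n \<alpha> r i)}"

end

(* The weight of agent k is the net coefficient of d(y, x_k) in the social cost: exchanging the
   order of summation gives SC(y) = sum_k (w_k d(y, x_k) + (1 - w_k)), and Res-M outputs a weighted
   median of the locations, which minimises this function. Since alpha_j (|G_j| - 1) <= 1, moving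
   the facility away from an agent never lowers the cost of that agent; as in the classical
   median argument, a misreport can only push the weighted median further away, the weights
   depending on the public group memberships alone. *)

theory Submission
  imports Defs
begin

section \<open>Weighted medians over a linear order\<close>

definition weighted_median :: "'a set \<Rightarrow> ('a \<Rightarrow> real) \<Rightarrow> ('a \<Rightarrow> 'b::linorder) \<Rightarrow> 'b" where
  "weighted_median A w x =
    Min {y \<in> x ` A. sum w {i \<in> A. x i > y} \<le> sum w {i \<in> A. x i \<le> y}}"

text \<open>The largest point qualifies, since no weight lies above it and the weights are
  nonnegative; so the minimum is taken over a nonempty set.\<close>

lemma weighted_median_mem:
  fixes x :: "'a \<Rightarrow> 'b::linorder"
  assumes "finite A" "A \<noteq> {}" and w: "\<And>i. i \<in> A \<Longrightarrow> w i \<ge> 0"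
  shows "weighted_median A w x \<in> x ` A" (is "?y \<in> _")
    and "sum w {i \<in> A. x i > weighted_median A w x} \<le> sum w {i \<in> A. x i \<le> weighted_median A w x}"
proof -
  let ?S = "{y \<in> x ` A. sum w {i \<in> A. x i > y} \<le> sum w {i \<in> A. x i \<le> y}}"
  have none: "{i \<in> A. x i > Max (x ` A)} = {}"
    using assms by (auto simp: not_less)
  have "Max (x ` A) \<in> ?S"
    unfolding mem_Collect_eq none using assms by (auto intro: sum_nonneg)
  then have "?S \<noteq> {}" by blast
  moreover have "finite ?S" using assms(1) by simp
  ultimately have "?y \<in> ?S"
    unfolding weighted_median_def by (intro Min_in)
  then show "?y \<in> x ` A" "sum w {i \<in> A. x i > ?y} \<le> sum w {i \<in> A. x i \<le> ?y}"
    by auto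
qed

(* The threshold z need not be one of the points; requiring a point at or below z covers the
   degenerate case of total weight 0, where the weighted median is the smallest point. *)
lemma weighted_median_le:
  fixes x :: "'a \<Rightarrow> 'b::linorder"
  assumes "finite A" "j \<in> A" "x j \<le> z"
    and le: "sum w {i \<in> A. x i > z} \<le> sum w {i \<in> A. x i \<le> z}"
  shows "weighted_median A w x \<le> z"
proof -
  \<comment> \<open>The largest point not above \<open>z\<close>: it splits the points exactly as
    \<open>z\<close> does, so it is a candidate in the minimum.\<close>
  define p where "p = Max {y \<in> x ` A. y \<le> z}"
  have fin: "finite {y \<in> x ` A. y \<le> z}" and "{y \<in> x ` A. y \<le> z} \<noteq> {}"
    using assms by auto
  then have p: "p \<in> x ` A" "p \<le> z"
    using Max_in[OF fin] by (auto simp: p_def)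
  have iff: "x i \<le> p \<longleftrightarrow> x i \<le> z" if "i \<in> A" for i
    using that p(2) Max_ge[OF fin, of "x i"] by (auto simp: p_def)
  have "{i \<in> A. x i \<le> p} = {i \<in> A. x i \<le> z}" "{i \<in> A. x i > p} = {i \<in> A. x i > z}"
    using iff by (auto, (metis leD leI)+)
  with le p(1) \<open>finite A\<close> have "weighted_median A w x \<le> p"
    unfolding weighted_median_def by (intro Min_le) auto
  with p(2) show ?thesis by simp
qed

lemma sum_below_above:
  fixes x :: "'a \<Rightarrow> 'b::linorder" and w :: "'a \<Rightarrow> real"
  assumes "finite A"
  shows "sum w {i \<in> A. x i \<le> z} + sum w {i \<in> A. x i > z} = sum w A"
  using assms by (subst sum.union_disjoint[symmetric]) (auto intro!: sum.cong)

text \<open>Mirror image of the defining inequality: if it failed, the largest point below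
  \<open>y\<close> would already be a candidate, against the minimality of \<open>y\<close>.\<close>

lemma sum_strictly_below_weighted_median:
  fixes x :: "'a \<Rightarrow> 'b::linorder"
  assumes "finite A" and w: "\<And>i. i \<in> A \<Longrightarrow> w i \<ge> 0"
  defines "y \<equiv> weighted_median A w x"
  shows "sum w {i \<in> A. x i < y} \<le> sum w {i \<in> A. x i \<ge> y}"
proof (rule ccontr)
  assume neg: "\<not> ?thesis"
  define p where "p = Max (x ` {i \<in> A. x i < y})"
  have "sum w {i \<in> A. x i \<ge> y} \<ge> 0"
    using w by (auto intro: sum_nonneg)
  with neg have ne: "{i \<in> A. x i < y} \<noteq> {}"
    by (auto simp del: Collect_empty_eq)
  have fin: "finite (x ` {i \<in> A. x i < y})"
    using assms(1) by simp
  have "p \<in> x ` {i \<in> A. x i < y}"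
    unfolding p_def using fin ne by (intro Max_in) auto
  then obtain j where j: "j \<in> A" "x j = p" "p < y" by auto
  have iff: "x i \<le> p \<longleftrightarrow> x i < y" if "i \<in> A" for i
    using that j(3) Max_ge[OF fin, of "x i"] by (auto simp: p_def)
  have "{i \<in> A. x i \<le> p} = {i \<in> A. x i < y}" "{i \<in> A. x i > p} = {i \<in> A. x i \<ge> y}"
    using iff by (auto, (metis leD leI)+)
  with neg have "y \<le> p"
    unfolding y_def by (intro weighted_median_le[OF assms(1) j(1)]) (use j in auto)
  with j(3) show False by simp
qed

text \<open>Moving from the median to \<open>z\<close> changes each distance by at least plus or
  minus the displacement; the weighted total of these bounds is nonnegative because the weights
  balance at the median.\<close>

lemma weighted_median_minimizes:
  fixes x :: "'a \<Rightarrow> real"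
  assumes "finite A" "A \<noteq> {}" and w: "\<And>i. i \<in> A \<Longrightarrow> w i \<ge> 0"
  shows "(\<Sum>i\<in>A. w i * \<bar>weighted_median A w x - x i\<bar>) \<le> (\<Sum>i\<in>A. w i * \<bar>z - x i\<bar>)"
proof -
  define y where "y = weighted_median A w x"
  have sum_split: "sum f A = sum f {i \<in> A. P i} + sum f {i \<in> A. \<not> P i}" for f :: "'a \<Rightarrow> real" and P
    using assms(1) by (subst sum.union_disjoint[symmetric]) (auto intro!: sum.cong)
  have "(\<Sum>i\<in>A. w i * \<bar>y - x i\<bar>) \<le> (\<Sum>i\<in>A. w i * \<bar>z - x i\<bar>)"
  proof (cases "y \<le> z")
    case True
    have "0 \<le> (z - y) * (sum w {i \<in> A. x i \<le> y} - sum w {i \<in> A. \<not> x i \<le> y})"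
      using True weighted_median_mem(2)[where w = w, OF assms, where x = x] by (auto simp: y_def not_le)
    also have "\<dots> = (\<Sum>i\<in>A. w i * (if x i \<le> y then z - y else y - z))"
      unfolding sum_split[of _ "\<lambda>i. x i \<le> y"]
      by (simp add: sum_distrib_left right_diff_distrib left_diff_distrib sum_subtractf mult.commute)
    also have "\<dots> \<le> (\<Sum>i\<in>A. w i * (\<bar>z - x i\<bar> - \<bar>y - x i\<bar>))"
      using w True by (intro sum_mono mult_left_mono) auto
    finally show ?thesis by (simp add: sum_subtractf algebra_simps)
  next
    case False
    \<comment> \<open>To the left, points equal to \<open>y\<close> become more distant and count
      with those above, so the balance for points strictly below \<open>y\<close> is used.\<close>
    have "0 \<le> (y - z) * (sum w {i \<in> A. \<not> x i < y} - sum w {i \<in> A. x i < y})"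
      using False sum_strictly_below_weighted_median[where w = w, OF assms(1) w, where x = x]
      by (auto simp: y_def not_less)
    also have "\<dots> = (\<Sum>i\<in>A. w i * (if x i < y then z - y else y - z))"
      unfolding sum_split[of _ "\<lambda>i. x i < y"]
      by (simp add: sum_distrib_left right_diff_distrib left_diff_distrib sum_subtractf mult.commute)
    also have "\<dots> \<le> (\<Sum>i\<in>A. w i * (\<bar>z - x i\<bar> - \<bar>y - x i\<bar>))"
      using w False by (intro sum_mono mult_left_mono) auto
    finally show ?thesis by (simp add: sum_subtractf algebra_simps)
  qed
  then show ?thesis by (simp add: y_def)
qed

text \<open>Used with \<open>x\<close> the truthful reports and \<open>x'\<close> the same reports
  with agent \<open>i\<close> misreporting: no move of \<open>i\<close> brings the median closer to
  \<open>x i\<close>.\<close>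

lemma weighted_median_between:
  fixes x x' :: "'a \<Rightarrow> 'b::linorder"
  assumes "finite A" "i \<in> A" and w: "\<And>k. k \<in> A \<Longrightarrow> w k \<ge> 0"
    and eq: "\<And>k. k \<in> A \<Longrightarrow> k \<noteq> i \<Longrightarrow> x' k = x k"
  defines "y \<equiv> weighted_median A w x" and "y' \<equiv> weighted_median A w x'"
  shows "x i \<le> y \<and> y \<le> y' \<or> y' \<le> y \<and> y \<le> x i"
proof -
  have A: "A \<noteq> {}" using assms(2) by auto
  note med = weighted_median_mem[where w = w, OF assms(1) A w]
  \<comment> \<open>The total weight is fixed, so a larger lower set inherits the balance.\<close>
  have below: "sum w {k \<in> A. v k > z'} \<le> sum w {k \<in> A. v k \<le> z'}"
    if "{k \<in> A. u k \<le> z} \<subseteq> {k \<in> A. v k \<le> z'}" "sum w {k \<in> A. u k > z} \<le> sum w {k \<in> A. u k \<le> z}"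
    for u v :: "'a \<Rightarrow> 'b" and z z'
  proof -
    have "sum w {k \<in> A. u k \<le> z} \<le> sum w {k \<in> A. v k \<le> z'}"
      using that(1) assms(1) w by (intro sum_mono2) auto
    with that(2) sum_below_above[OF assms(1), of w u z] sum_below_above[OF assms(1), of w v z']
    show ?thesis by linarith
  qed
  consider "x i < y" | "x i = y" | "x i > y" by fastforce
  then show ?thesis
  proof cases
    case 1
    \<comment> \<open>The maximum keeps agent \<open>i\<close> in the lower set wherever
      \<open>x' i\<close> is, and makes \<open>i\<close> the point required at or below the
      threshold.\<close>
    have "{k \<in> A. x' k \<le> y'} \<subseteq> {k \<in> A. x k \<le> max (x i) y'}"
      using eq by (auto simp: le_max_iff_disj, metis order_refl)
    then have "sum w {k \<in> A. x k > max (x i) y'} \<le> sum w {k \<in> A. x k \<le> max (x i) y'}"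
      by (rule below) (use med(2)[where x = x'] in \<open>simp add: y'_def\<close>)
    then have "y \<le> max (x i) y'"
      unfolding y_def by (intro weighted_median_le[OF assms(1,2)]) auto
    with 1 show ?thesis by (auto simp: le_max_iff_disj)
  next
    case 2
    then show ?thesis by (simp add: linear)
  next
    case 3
    \<comment> \<open>This \<open>j\<close> differs from \<open>i\<close> because
      \<open>x i > y\<close>; hence it stays at \<open>y\<close> and is a point of \<open>x'\<close>
      at or below the threshold.\<close>
    from med(1)[where x = x] obtain j where j: "j \<in> A" "x j = y" by (auto simp: y_def)
    have "{k \<in> A. x k \<le> y} \<subseteq> {k \<in> A. x' k \<le> y}"
      using 3 eq by (auto, metis leD)
    then have "sum w {k \<in> A. x' k > y} \<le> sum w {k \<in> A. x' k \<le> y}"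
      by (rule below) (use med(2)[where x = x] in \<open>simp add: y_def\<close>)
    moreover have "x' j \<le> y" using 3 j eq[of j] by (cases "j = i") auto
    ultimately have "y' \<le> y"
      unfolding y'_def by (intro weighted_median_le[OF assms(1) j(1)]) auto
    with 3 show ?thesis by auto
  qed
qed

section \<open>Weights, individual costs and social cost\<close>

lemma res_m_eq_weighted_median:
  "res_m n \<alpha> r = weighted_median {1..n} (weight n \<alpha> r) (loc r)"
  by (simp add: res_m_def weighted_median_def)

lemma finite_members [simp]: "finite (members n r j)"
  by (simp add: members_def)

lemma members_cong:
  assumes "\<And>k. k \<in> {1..n} \<Longrightarrow> grp r' k = grp r k"
  shows "members n r' j = members n r j"
  using assms by (auto simp: members_def)

lemma card_members_Diff:
  assumes "i \<in> {1..n}"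
  shows "real (card (members n r (grp r i) - {i})) = real (card (members n r (grp r i))) - 1"
proof -
  have "i \<in> members n r (grp r i)" using assms by (simp add: members_def)
  then have "card (members n r (grp r i)) = Suc (card (members n r (grp r i) - {i}))"
    by (intro card.remove finite_members)
  then show ?thesis by simp
qed

lemma profiles_memD:
  assumes "r \<in> profiles n m \<alpha>" "i \<in> {1..n}"
  shows "grp r i \<in> {1..m}" and "loc r i \<in> {0..1}"
proof -
  have "r i \<in> {0..1} \<times> {1..m}"
    using assms by (auto simp: profiles_def PiE_iff)
  then show "grp r i \<in> {1..m}" "loc r i \<in> {0..1}" by (auto simp: mem_Times_iff)
qed

lemma weight_nonneg:
  assumes "r \<in> profiles n m \<alpha>" "i \<in> {1..n}"
  shows "weight n \<alpha> r i \<ge> 0"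
proof -
  let ?c = "card (members n r (grp r i))"
  have c: "real ?c - 1 = real (card (members n r (grp r i) - {i}))"
    using card_members_Diff[OF assms(2)] by simp
  show ?thesis
  proof (cases "1 < ?c")
    case True
    with assms profiles_memD[OF assms] have "\<alpha> (grp r i) \<le> 1 / (real ?c - 1)"
      by (auto simp: profiles_def)
    with True show ?thesis by (simp add: weight_def field_simps)
  next
    case False
    \<comment> \<open>Agent \<open>i\<close> belongs to its own group, so the group has exactly one
      member.\<close>
    then have "real ?c - 1 = 0" using c by linarith
    then show ?thesis by (simp add: weight_def)
  qed
qed

text \<open>Agent \<open>i\<close>'s own distance grows by the full displacement \<open>D\<close>,
  while each externality term drops by at most \<open>D\<close>. Nonnegativity of the weight says
  that the factor times the number of other members is at most 1, so the drop cannot exceed the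
  growth.\<close>

lemma cost_mono_away:
  assumes r: "r \<in> profiles n m \<alpha>" and i: "i \<in> {1..n}" and \<alpha>: "\<forall>j\<in>{1..m}. \<alpha> j \<ge> 0"
    and btw: "loc r i \<le> y \<and> y \<le> y' \<or> y' \<le> y \<and> y \<le> loc r i"
  shows "cost n \<alpha> i y r \<le> cost n \<alpha> i y' r"
proof -
  let ?a = "\<alpha> (grp r i)" and ?B = "members n r (grp r i) - {i}"
  have a: "?a \<ge> 0" using \<alpha> profiles_memD(1)[OF r i] by auto
  define S where "S z = (\<Sum>k\<in>?B. 1 - \<bar>z - loc r k\<bar>)" for z
  define D where "D = \<bar>y' - y\<bar>"
  have "S y \<le> (\<Sum>k\<in>?B. (1 - \<bar>y' - loc r k\<bar>) + D)"
    unfolding S_def D_def by (intro sum_mono) linarith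
  also have "\<dots> = S y' + card ?B * D"
    by (simp only: sum.distrib sum_constant S_def)
  finally have "?a * S y \<le> ?a * S y' + (?a * card ?B) * D"
    using mult_left_mono[OF _ a] by (simp only: distrib_left[symmetric] mult.assoc)
  moreover have "(?a * card ?B) * D \<le> 1 * D"
    using weight_nonneg[OF r i] card_members_Diff[OF i, of r]
    by (intro mult_right_mono) (auto simp: weight_def D_def)
  moreover have "\<bar>y - loc r i\<bar> + D = \<bar>y' - loc r i\<bar>"
    using btw by (auto simp: D_def)
  ultimately show ?thesis unfolding cost_def S_def[symmetric] by linarith
qed

lemma social_cost_eq:
  "social_cost n \<alpha> y r =
    (\<Sum>k\<in>{1..n}. weight n \<alpha> r k * \<bar>y - loc r k\<bar>) + (\<Sum>k\<in>{1..n}. 1 - weight n \<alpha> r k)"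
proof -
  let ?h = "\<lambda>k. 1 - \<bar>y - loc r k\<bar>"
  let ?B = "\<lambda>i. members n r (grp r i) - {i}"
  have "(\<Sum>i\<in>{1..n}. \<alpha> (grp r i) * sum ?h (?B i))
      = (\<Sum>i\<in>{1..n}. \<Sum>k\<in>?B i. \<alpha> (grp r i) * ?h k)"
    by (simp only: sum_distrib_left)
  also have "\<dots> = (\<Sum>i\<in>{1..n}. \<Sum>k\<in>{k \<in> {1..n}. k \<noteq> i \<and> grp r k = grp r i}. \<alpha> (grp r i) * ?h k)"
    by (intro sum.cong refl) (auto simp: members_def)
  \<comment> \<open>Being distinct members of one group is symmetric, so the sums can be
    exchanged.\<close>
  also have "\<dots> = (\<Sum>k\<in>{1..n}. \<Sum>i\<in>{i \<in> {1..n}. k \<noteq> i \<and> grp r k = grp r i}. \<alpha> (grp r i) * ?h k)"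
    by (rule sum.swap_restrict) auto
  \<comment> \<open>Both agents share a factor, so the summand is now constant in
    \<open>i\<close>.\<close>
  also have "\<dots> = (\<Sum>k\<in>{1..n}. \<Sum>i\<in>?B k. \<alpha> (grp r k) * ?h k)"
    by (intro sum.cong refl) (auto simp: members_def)
  also have "\<dots> = (\<Sum>k\<in>{1..n}. (1 - weight n \<alpha> r k) * ?h k)"
    by (intro sum.cong refl) (simp only: sum_constant card_members_Diff, simp add: weight_def)
  finally show ?thesis
    unfolding social_cost_def cost_def sum.distrib
    by (simp only: sum.distrib[symmetric]) (simp add: algebra_simps)
qed

section \<open>Strategyproofness and optimality of Res-M\<close>

theorem theorem2:
  fixes n m :: nat and \<alpha> :: "nat \<Rightarrow> real"
  assumes "n \<ge> 1"
    and "\<forall>j\<in>{1..m}. \<alpha> j \<ge> 0"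
  shows "strategyproof n m \<alpha> (res_m n \<alpha>) \<and> optimal n m \<alpha> (res_m n \<alpha>)"
proof
  show "strategyproof n m \<alpha> (res_m n \<alpha>)"
    unfolding strategyproof_def
  proof (intro ballI impI)
    fix r r' i
    assume r: "r \<in> profiles n m \<alpha>" and r': "r' \<in> profiles n m \<alpha>"
      and grp: "\<forall>k\<in>{1..n}. grp r' k = grp r k" and i: "i \<in> {1..n}"
    let ?t = "r'(i := r i)"
    have "members n ?t j = members n r' j" for j
      by (rule members_cong) (use grp i in auto)
    \<comment> \<open>Weights see only the groups, so both outputs are medians for the same
      weights.\<close>
    then have "weight n \<alpha> ?t = weight n \<alpha> r'"
      using grp i by (auto simp: weight_def fun_eq_iff)
    then have t: "res_m n \<alpha> ?t = weighted_median {1..n} (weight n \<alpha> r') (loc ?t)"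
      by (simp only: res_m_eq_weighted_median)
    show "cost n \<alpha> i (res_m n \<alpha> ?t) r \<le> cost n \<alpha> i (res_m n \<alpha> r') r"
      unfolding t unfolding res_m_eq_weighted_median
    proof (rule cost_mono_away[OF r i assms(2)])
      show "loc r i \<le> weighted_median {1..n} (weight n \<alpha> r') (loc ?t)
          \<and> weighted_median {1..n} (weight n \<alpha> r') (loc ?t)
            \<le> weighted_median {1..n} (weight n \<alpha> r') (loc r')
        \<or> weighted_median {1..n} (weight n \<alpha> r') (loc r')
            \<le> weighted_median {1..n} (weight n \<alpha> r') (loc ?t)
          \<and> weighted_median {1..n} (weight n \<alpha> r') (loc ?t) \<le> loc r i"
        using weighted_median_between[of "{1..n}" i "weight n \<alpha> r'" "loc r'" "loc ?t"]
          weight_nonneg[OF r'] i by simp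
    qed
  qed
next
  show "optimal n m \<alpha> (res_m n \<alpha>)"
    unfolding optimal_def is_arg_min_linorder
  proof (intro ballI conjI allI impI)
    fix r
    assume r: "r \<in> profiles n m \<alpha>"
    have ne: "{1..n} \<noteq> {}" using assms(1) by simp
    note med = finite_atLeastAtMost ne weight_nonneg[OF r]
    \<comment> \<open>The output is the location of some agent.\<close>
    show "res_m n \<alpha> r \<in> {0..1}"
      using weighted_median_mem(1)[where w = "weight n \<alpha> r" and x = "loc r", OF med] profiles_memD(2)[OF r]
      unfolding res_m_eq_weighted_median by auto
    show "social_cost n \<alpha> (res_m n \<alpha> r) r \<le> social_cost n \<alpha> z r" for z
      unfolding social_cost_eq res_m_eq_weighted_median
      \<comment> \<open>The second sum in \<open>social_cost_eq\<close> is independent of the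
        facility.\<close>
      by (intro add_right_mono weighted_median_minimizes med)
  qed
qed

end
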